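(* There exists a complete path metric space $X$ (a metric graph) quasi-isometric to $\mathbb{R}$ such that: a. $K_3(X)$ does not contain $\partial K_3(\mathbb{R}^2)$. b. $K_3(X^2)$ does not contain $\partial K_3(\mathbb{R}^2)$. Moreover, there exists $D<\infty$ such that for every degenerate triangle in $X$ and in $X^2$, at least one side is $\le D$.
   Context: $\mathbb{R}_+=[0,\infty)$. For a metric space $(X,d)$, $K_3(X)$ is the set of all $(a,b,c)\in\mathbb{R}_+^3$ for which there exist points $x,y,z\in X$ with $d(x,y)=a$, $d(y,z)=b$, $d(z,x)=c$. Thus $K_3(\mathbb{R}^2)=\{(a,b,c)\in\mathbb{R}_+^3: a\le b+c,\ b\le a+c,\ c\le a+b\}$, and $\partial K_3(\mathbb{R}^2)$ is its boundary in $\mathbb{R}^3$. $X^2=X\times X$ carries the product metric $d^2((x_1,y_1),(x_2,y_2))=d^2(x_1,x_2)+d^2(y_1,y_2)$, i.e. the $\ell^2$-product metric. A triangle in a metric space is an ordered triple of points $(x,y,z)$; its side-lengths are $d(x,y),d(y,z),d(z,x)$. A triangle is degenerate if, after reordering its side-lengths as $a,b,c$, one has $a\ge b+c$ (equivalently $a=b+c$). A path metric space is a metric space $X$ such that for all $x,y\in X$, $d(x,y)$ equals the infimum of the lengths of continuous paths in $X$ connecting $x$ to $y$. A metric graph is a connected graph whose edges are assigned positive lengths, with the induced path metric. A map $f:X\to Y$ of metric spaces is an $(L,A)$-quasi-isometry ($L\ge 1$, $A\in\mathbb{R}$) if $L^{-1}d(x_1,x_2)-A\le d(f(x_1),f(x_2))\le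 L\,d(x_1,x_2)+A$ for all $x_1,x_2\in X$ and every point of $Y$ is at distance $\le A$ from $f(X)$. $X$ and $Y$ are quasi-isometric if there is an $(L,A)$-quasi-isometry $X\to Y$ for some $L,A$. *)

theory Defs
  imports "HOL-Analysis.Analysis" "Graph_Theory.Digraph_Component"
begin

hide_const (open) Digraph_Component.connected

section \<open>Triangles\<close>

definition K3 :: "'a set \<Rightarrow> ('a \<Rightarrow> 'a \<Rightarrow> real) \<Rightarrow> (real \<times> real \<times> real) set" where
  "K3 M d = {(d x y, d y z, d z x) | x y z. x \<in> M \<and> y \<in> M \<and> z \<in> M}"

definition degenerate_sides :: "real \<Rightarrow> real \<Rightarrow> real \<Rightarrow> bool" where
  "degenerate_sides a b c \<longleftrightarrow> a \<ge> b + c \<or> b \<ge> a + c \<or> c \<ge> a + b"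

definition degenerate_triangles_bounded ::
    "real \<Rightarrow> 'a set \<Rightarrow> ('a \<Rightarrow> 'a \<Rightarrow> real) \<Rightarrow> bool" where
  "degenerate_triangles_bounded D M d \<longleftrightarrow>
     (\<forall>x\<in>M. \<forall>y\<in>M. \<forall>z\<in>M. degenerate_sides (d x y) (d y z) (d z x) \<longrightarrow>
        d x y \<le> D \<or> d y z \<le> D \<or> d z x \<le> D)"

section \<open>Path metric spaces\<close>

definition curve_length :: "('a \<Rightarrow> 'a \<Rightarrow> real) \<Rightarrow> (real \<Rightarrow> 'a) \<Rightarrow> ereal" where
  "curve_length d g =
     (SUP ts \<in> {ts. sorted ts \<and> set ts \<subseteq> {0..1}}.
        ereal (\<Sum>i < length ts - 1. d (g (ts ! i)) (g (ts ! Suc i))))"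

definition path_metric_space :: "'a set \<Rightarrow> ('a \<Rightarrow> 'a \<Rightarrow> real) \<Rightarrow> bool" where
  "path_metric_space M d \<longleftrightarrow> Metric_space M d \<and>
     (\<forall>x\<in>M. \<forall>y\<in>M. ereal (d x y) =
        (INF g \<in> {g. pathin (Metric_space.mtopology M d) g \<and> g 0 = x \<and> g 1 = y}.
           curve_length d g))"

section \<open>Quasi-isometries\<close>

definition quasi_isometry ::
    "real \<Rightarrow> real \<Rightarrow> 'a set \<Rightarrow> ('a \<Rightarrow> 'a \<Rightarrow> real) \<Rightarrow> 'b set \<Rightarrow> ('b \<Rightarrow> 'b \<Rightarrow> real)
       \<Rightarrow> ('a \<Rightarrow> 'b) \<Rightarrow> bool" where
  "quasi_isometry L A M d N d' f \<longleftrightarrow>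
     L \<ge> 1 \<and> f \<in> M \<rightarrow> N \<and>
     (\<forall>x\<in>M. \<forall>y\<in>M. inverse L * d x y - A \<le> d' (f x) (f y) \<and>
                     d' (f x) (f y) \<le> L * d x y + A) \<and>
     (\<forall>y\<in>N. \<exists>x\<in>M. d' y (f x) \<le> A)"

definition quasi_isometric ::
    "'a set \<Rightarrow> ('a \<Rightarrow> 'a \<Rightarrow> real) \<Rightarrow> 'b set \<Rightarrow> ('b \<Rightarrow> 'b \<Rightarrow> real) \<Rightarrow> bool" where
  "quasi_isometric M d N d' \<longleftrightarrow> (\<exists>L A f. quasi_isometry L A M d N d' f)"

section \<open>Metric graphs\<close>

text \<open>
  A graph is encoded as a directed multigraph in which every edge carries an arbitrarily
  chosen orientation; loops and multiple edges are allowed.  The orientation only serves to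
  parametrise the edge \<open>e\<close> by \<open>[0, len e]\<close>, and connectedness is that of the underlying
  undirected graph.
\<close>

definition metric_graph :: "('v, 'e) pre_digraph \<Rightarrow> ('e \<Rightarrow> real) \<Rightarrow> bool" where
  "metric_graph G len \<longleftrightarrow>
     wf_digraph G \<and> Digraph_Component.connected G \<and> (\<forall>e \<in> arcs G. len e > 0)"

datatype ('v, 'e) graph_point = Vertex 'v | Inner 'e real

definition graph_points :: "('v, 'e) pre_digraph \<Rightarrow> ('e \<Rightarrow> real) \<Rightarrow> ('v, 'e) graph_point set" where
  "graph_points G len =
     Vertex ` verts G \<union> {Inner e t | e t. e \<in> arcs G \<and> 0 < t \<and> t < len e}"

definition edge_point ::
    "('v, 'e) pre_digraph \<Rightarrow> ('e \<Rightarrow> real) \<Rightarrow> 'e \<Rightarrow> real \<Rightarrow> ('v, 'e) graph_point" where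
  "edge_point G len e t =
     (if t \<le> 0 then Vertex (tail G e)
      else if t \<ge> len e then Vertex (head G e)
      else Inner e t)"

text \<open>
  \<open>pl_path G len x y l\<close>: there is a piecewise linear path of length \<open>l\<close> from \<open>x\<close> to \<open>y\<close>,
  i.e. a finite concatenation of segments, each contained in a single closed edge.
\<close>

inductive pl_path ::
    "('v, 'e) pre_digraph \<Rightarrow> ('e \<Rightarrow> real) \<Rightarrow> ('v, 'e) graph_point \<Rightarrow> ('v, 'e) graph_point
       \<Rightarrow> real \<Rightarrow> bool"
  for G len where
  refl: "x \<in> graph_points G len \<Longrightarrow> pl_path G len x x 0"
| step: "pl_path G len x (edge_point G len e s) l \<Longrightarrow> e \<in> arcs G \<Longrightarrow>
     s \<in> {0..len e} \<Longrightarrow> t \<in> {0..len e} \<Longrightarrow>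
     pl_path G len x (edge_point G len e t) (l + \<bar>s - t\<bar>)"

text \<open>
  In a connected graph any two points of \<open>graph_points G len\<close> are joined by a piecewise linear
  path, so the second branch only concerns arguments outside the space; it is needed because
  \<^locale>\<open>Metric_space\<close> demands non-negativity on the whole type.  Without a positive lower
  bound on the edge lengths this is in general only a pseudometric.
\<close>

definition graph_dist ::
    "('v, 'e) pre_digraph \<Rightarrow> ('e \<Rightarrow> real) \<Rightarrow> ('v, 'e) graph_point \<Rightarrow> ('v, 'e) graph_point
       \<Rightarrow> real" where
  "graph_dist G len x y =
     (if \<exists>l. pl_path G len x y l then Inf {l. pl_path G len x y l} else 0)"

end

theory Submission
  imports Defs
begin

text \<open>
  The vertices are arranged in layers indexed by the integers, each layer being infinite with
  vertex weights in \<open>(0, 1]\<close> tending to \<open>0\<close>, and any two vertices \<open>u\<close>, \<open>v\<close> of consecutive layers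
  are joined by an edge of length \<open>1 + weight u + weight v\<close>.  A chain through layers
  \<open>i < \<dots> < j\<close> may use intermediate vertices of arbitrarily small weight, so the
  distance between its ends is \<open>j - i + weight u + weight v\<close>, but this infimum is not attained:
  prescribing an intermediate vertex \<open>v\<close> costs an extra \<open>2 * weight v > 0\<close>.  Hence no far away
  point lies metrically between two others.  In the \<open>\<ell>\<^sup>2\<close>-product a degenerate triangle
  projects to degenerate triangles in both factors, with proportional sides, by the equality case
  of Minkowski's inequality.
\<close>

section \<open>Path metric spaces from Lipschitz curves\<close>

lemma dist_le_curve_length: "ereal (d (g 0) (g 1)) \<le> curve_length d g"
  unfolding curve_length_def by (rule SUP_upper2[of "[0, 1]"]) auto

lemma curve_length_Lipschitz:
  assumes "L \<ge> 0" and Lip: "\<And>s t. s \<in> {0..1} \<Longrightarrow> t \<in> {0..1} \<Longrightarrow> d (g s) (g t) \<le> L * \<bar>s - t\<bar>"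
  shows "curve_length d g \<le> ereal L"
  unfolding curve_length_def
proof (rule SUP_least)
  fix ts :: "real list" assume "ts \<in> {ts. sorted ts \<and> set ts \<subseteq> {0..1}}"
  then have ts: "sorted ts" "\<And>i. i < length ts \<Longrightarrow> ts ! i \<in> {0..1}"
    using nth_mem by blast+
  define k where "k = length ts - 1"
  have "(\<Sum>i<k. d (g (ts ! i)) (g (ts ! Suc i))) \<le> (\<Sum>i<k. L * (ts ! Suc i - ts ! i))"
  proof (rule sum_mono)
    fix i assume "i \<in> {..<k}"
    then have i: "Suc i < length ts" by (auto simp: k_def)
    then have "ts ! i \<le> ts ! Suc i" using ts(1) by (intro sorted_nth_mono) auto
    then show "d (g (ts ! i)) (g (ts ! Suc i)) \<le> L * (ts ! Suc i - ts ! i)"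
      using Lip[OF ts(2) ts(2), of i "Suc i"] i by simp
  qed
  also have "\<dots> = L * (ts ! k - ts ! 0)"
    by (simp add: sum_lessThan_telescope flip: sum_distrib_left)
  also have "\<dots> \<le> L"
  proof (cases ts)
    case Cons
    then have "ts ! k \<le> 1" "ts ! 0 \<ge> 0" using ts(2)[of k] ts(2)[of 0] by (auto simp: k_def)
    then show ?thesis using assms(1) mult_left_mono[of "ts ! k - ts ! 0" 1 L] by simp
  qed (use assms(1) in \<open>simp add: k_def\<close>)
  finally show "ereal (\<Sum>i<length ts - 1. d (g (ts ! i)) (g (ts ! Suc i))) \<le> ereal L"
    by (simp add: k_def)
qed

lemma (in Metric_space) pathin_Lipschitz:
  assumes M: "\<And>t. t \<in> {0..1} \<Longrightarrow> g t \<in> M"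
    and Lip: "\<And>s t. s \<in> {0..1} \<Longrightarrow> t \<in> {0..1} \<Longrightarrow> d (g s) (g t) \<le> L * \<bar>s - t\<bar>"
  shows "pathin mtopology g"
  unfolding pathin_def continuous_map_to_metric
proof (intro ballI allI impI)
  fix s \<epsilon> :: real assume "s \<in> topspace (subtopology euclideanreal {0..1})" and \<epsilon>: "\<epsilon> > 0"
  then have s: "s \<in> {0..1}" by simp
  \<comment> \<open>The hypotheses do not fix the sign of \<open>L\<close>;
    \<open>\<bar>L\<bar> + 1\<close> is a positive Lipschitz constant in any case.\<close>
  define r where "r = \<epsilon> / (\<bar>L\<bar> + 1)"
  have r: "r > 0" using \<epsilon> by (simp add: r_def)
  have "d (g s) (g t) < \<epsilon>" if t: "t \<in> {0..1}" "dist s t < r" for t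
  proof -
    have "L * \<bar>s - t\<bar> \<le> (\<bar>L\<bar> + 1) * \<bar>s - t\<bar>" by (intro mult_right_mono) auto
    also have "\<dots> < (\<bar>L\<bar> + 1) * r" using t(2) by (intro mult_strict_left_mono) (auto simp: dist_real_def)
    also have "\<dots> = \<epsilon>" by (simp add: r_def add_nonneg_eq_0_iff)
    finally show ?thesis using Lip[OF s t(1)] by linarith
  qed
  then show "\<exists>U. openin (subtopology euclideanreal {0..1}) U \<and> s \<in> U \<and> (\<forall>t\<in>U. g t \<in> mball (g s) \<epsilon>)"
    using s r M by (intro exI[of _ "{0..1} \<inter> ball s r"]) (auto simp: openin_open)
qed

section \<open>Metric graphs with edge lengths bounded below\<close>

text \<open>The uniform bound \<open>\<delta>\<close> keeps distinct vertices a fixed distance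
  apart. This turns the path pseudometric into a metric and makes it complete.\<close>

locale uniform_metric_graph =
  fixes G :: "('v, 'e) pre_digraph" and len :: "'e \<Rightarrow> real" and \<delta> :: real
  assumes graph: "metric_graph G len"
    and delta_pos: "\<delta> > 0"
    and delta_le: "\<And>e. e \<in> arcs G \<Longrightarrow> \<delta> \<le> len e"
begin

abbreviation "X \<equiv> graph_points G len"
abbreviation "d \<equiv> graph_dist G len"
abbreviation "ep \<equiv> edge_point G len"

lemma len_pos: "e \<in> arcs G \<Longrightarrow> len e > 0"
  using graph by (auto simp: metric_graph_def)

lemma tail_vertex: "e \<in> arcs G \<Longrightarrow> tail G e \<in> verts G"
  and head_vertex: "e \<in> arcs G \<Longrightarrow> head G e \<in> verts G"
  using graph by (auto simp: metric_graph_def wf_digraph_def)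

lemma Vertex_in [simp]: "Vertex v \<in> X \<longleftrightarrow> v \<in> verts G"
  and Inner_in [simp]: "Inner e t \<in> X \<longleftrightarrow> e \<in> arcs G \<and> 0 < t \<and> t < len e"
  by (auto simp: graph_points_def)

section \<open>Points of closed edges and piecewise linear paths\<close>

lemma edge_point_0: "ep e 0 = Vertex (tail G e)"
  by (simp add: edge_point_def)

lemma edge_point_len: "e \<in> arcs G \<Longrightarrow> ep e (len e) = Vertex (head G e)"
  using len_pos[of e] by (simp add: edge_point_def)

lemma edge_point_Inner: "0 < t \<Longrightarrow> t < len e \<Longrightarrow> ep e t = Inner e t"
  by (simp add: edge_point_def)

lemma edge_point_cases:
  assumes "e \<in> arcs G" "t \<in> {0..len e}"
  obtains "t = 0" "ep e t = Vertex (tail G e)" | "t = len e" "ep e t = Vertex (head G e)"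
    | "0 < t" "t < len e" "ep e t = Inner e t"
proof -
  consider "t = 0" | "t = len e" | "0 < t" "t < len e"
    using assms by fastforce
  thus ?thesis
    using that edge_point_0 edge_point_len edge_point_Inner assms by cases auto
qed

lemma edge_point_in: "e \<in> arcs G \<Longrightarrow> ep e t \<in> X"
  using tail_vertex head_vertex by (auto simp: edge_point_def)

lemma pl_path_in:
  assumes "pl_path G len x y l"
  shows "x \<in> X" "y \<in> X" "l \<ge> 0"
  using assms by (induction rule: pl_path.induct) (auto simp: edge_point_in)

text \<open>\<open>pl_path\<close> grows at its end, so the induction runs over the second of the
  two paths; that path therefore comes first among the premises.\<close>

lemma pl_path_trans:
  assumes "pl_path G len y z m" "pl_path G len x y l"
  shows "pl_path G len x z (l + m)"
  using assms
proof (induction arbitrary: rule: pl_path.induct)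
  case (refl y)
  then show ?case by simp
next
  case (step y e s m t)
  then have "pl_path G len x (ep e t) (l + m + \<bar>s - t\<bar>)"
    by (intro pl_path.step) auto
  then show ?case by (simp add: add.assoc)
qed

lemma pl_path_segment:
  assumes "e \<in> arcs G" "s \<in> {0..len e}" "t \<in> {0..len e}"
  shows "pl_path G len (ep e s) (ep e t) \<bar>s - t\<bar>"
  using pl_path.step[OF pl_path.refl[OF edge_point_in[OF assms(1)]] assms] by simp

lemma pl_path_sym:
  assumes "pl_path G len x y l"
  shows "pl_path G len y x l"
  using assms
proof (induction rule: pl_path.induct)
  case (refl x)
  then show ?case by (rule pl_path.refl)
next
  case (step x e s l t)
  have "pl_path G len (ep e t) x (\<bar>t - s\<bar> + l)"
    by (rule pl_path_trans[OF step.IH pl_path_segment]) (use step in auto)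
  then show ?case by (simp add: abs_minus_commute add.commute)
qed

lemma pl_path_Vertex:
  assumes "u \<in> verts G" "v \<in> verts G"
  shows "\<exists>l. pl_path G len (Vertex u) (Vertex v) l"
proof -
  have "(u, v) \<in> rtrancl_on (verts G) (\<Union>e\<in>arcs G. {(tail G e, head G e), (head G e, tail G e)})"
    using graph assms
    by (auto simp: metric_graph_def Digraph_Component.connected_def strongly_connected_def
        reachable_def parcs_mk_symmetric)
  then show ?thesis
  proof (induction rule: rtrancl_on_induct)
    case base
    then show ?case using assms by (auto intro!: exI pl_path.refl)
  next
    case (step v w)
    then obtain e where e: "e \<in> arcs G" "(v, w) = (tail G e, head G e) \<or> (v, w) = (head G e, tail G e)"
      by auto
    have "pl_path G len (Vertex (tail G e)) (Vertex (head G e)) (len e)"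
      using pl_path_segment[OF e(1), of 0 "len e"] len_pos[OF e(1)] edge_point_0[of e] edge_point_len[OF e(1)]
      by simp
    then have "pl_path G len (Vertex v) (Vertex w) (len e)"
      using e(2) pl_path_sym by auto
    then show ?case using step.IH pl_path_trans by blast
  qed
qed

lemma pl_path_to_Vertex:
  assumes "x \<in> X"
  obtains v l where "v \<in> verts G" "pl_path G len x (Vertex v) l"
proof (cases x)
  case (Vertex v)
  then show ?thesis using that[of v 0] assms by (simp add: pl_path.refl)
next
  case (Inner e t)
  then have e: "e \<in> arcs G" "0 < t" "t < len e" using assms by auto
  then have "pl_path G len (ep e t) (ep e 0) \<bar>t - 0\<bar>"
    by (intro pl_path_segment) auto
  then show ?thesis
    using that[OF tail_vertex[OF e(1)]] e Inner by (auto simp: edge_point_0 edge_point_Inner)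
qed

lemma pl_path_exists:
  assumes "x \<in> X" "y \<in> X"
  shows "\<exists>l. pl_path G len x y l"
proof -
  obtain u k where u: "u \<in> verts G" "pl_path G len x (Vertex u) k"
    using assms(1) by (rule pl_path_to_Vertex)
  obtain v m where v: "v \<in> verts G" "pl_path G len y (Vertex v) m"
    using assms(2) by (rule pl_path_to_Vertex)
  show ?thesis
    using pl_path_Vertex[OF u(1) v(1)] u(2) pl_path_sym[OF v(2)] pl_path_trans by blast
qed

section \<open>The infimum of path lengths as a distance\<close>

lemma bdd_below_pl_path: "bdd_below {l. pl_path G len x y l}"
  by (rule bdd_belowI[of _ 0]) (auto dest: pl_path_in(3))

lemma dist_le: "pl_path G len x y l \<Longrightarrow> d x y \<le> l"
  using cInf_lower[OF _ bdd_below_pl_path, of l x y] by (auto simp: graph_dist_def)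

lemma dist_greatest:
  assumes "x \<in> X" "y \<in> X" "\<And>l. pl_path G len x y l \<Longrightarrow> c \<le> l"
  shows "c \<le> d x y"
proof -
  have "c \<le> Inf {l. pl_path G len x y l}"
    using pl_path_exists[OF assms(1,2)] assms(3) by (intro cInf_greatest) auto
  then show ?thesis
    using pl_path_exists[OF assms(1,2)] by (simp add: graph_dist_def)
qed

lemma dist_approx:
  assumes "x \<in> X" "y \<in> X" "d x y < c"
  obtains l where "pl_path G len x y l" "l < c"
  using dist_greatest[OF assms(1,2), of c] assms(3) by (meson not_le)

lemma dist_nonneg: "d x y \<ge> 0"
proof (cases "\<exists>l. pl_path G len x y l")
  case True
  then have "x \<in> X" "y \<in> X" using pl_path_in by auto
  then show ?thesis by (rule dist_greatest) (rule pl_path_in(3))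
qed (simp add: graph_dist_def)

lemma dist_commute: "d x y = d y x"
proof -
  have "pl_path G len x y = pl_path G len y x"
    by (intro ext iffI) (erule pl_path_sym)+
  then show ?thesis
    unfolding graph_dist_def by (rule arg_cong[where f = "\<lambda>P. if Ex P then Inf (Collect P) else 0"])
qed

lemma dist_triangle:
  assumes "x \<in> X" "y \<in> X" "z \<in> X"
  shows "d x z \<le> d x y + d y z"
proof (rule field_le_epsilon)
  fix \<epsilon> :: real assume "\<epsilon> > 0"
  then have less: "d x y < d x y + \<epsilon>/2" "d y z < d y z + \<epsilon>/2"
    by simp_all
  obtain k where k: "pl_path G len x y k" "k < d x y + \<epsilon>/2"
    by (rule dist_approx[OF assms(1,2) less(1)])
  obtain l where l: "pl_path G len y z l" "l < d y z + \<epsilon>/2"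
    by (rule dist_approx[OF assms(2,3) less(2)])
  show "d x z \<le> d x y + d y z + \<epsilon>"
    using dist_le[OF pl_path_trans[OF l(1) k(1)]] k(2) l(2) by simp
qed

lemma dist_edge_le:
  assumes "e \<in> arcs G" "s \<in> {0..len e}" "t \<in> {0..len e}"
  shows "d (ep e s) (ep e t) \<le> \<bar>s - t\<bar>"
  using dist_le[OF pl_path_segment[OF assms]] .

lemma dist_self: "x \<in> X \<Longrightarrow> d x x = 0"
  using dist_le[OF pl_path.refl, of x] dist_nonneg[of x x] by simp

text \<open>Lower bounds on distances come from functions that are 1-Lipschitz along every edge.\<close>

lemma Lipschitz_potential:
  fixes F :: "('v, 'e) graph_point \<Rightarrow> real"
  assumes F: "\<And>e s t. e \<in> arcs G \<Longrightarrow> s \<in> {0..len e} \<Longrightarrow> t \<in> {0..len e} \<Longrightarrow>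
      F (ep e t) \<le> F (ep e s) + \<bar>s - t\<bar>"
    and xy: "x \<in> X" "y \<in> X"
  shows "F y \<le> F x + d x y"
proof -
  have "F y \<le> F x + l" if "pl_path G len x y l" for l
    using that
  proof (induction rule: pl_path.induct)
    case (step x e s l t)
    have "F (ep e t) \<le> F (ep e s) + \<bar>s - t\<bar>"
      using step.hyps by (intro F)
    with step.IH show ?case by linarith
  qed simp
  then have "F y - F x \<le> d x y"
    using xy by (intro dist_greatest) (auto simp: algebra_simps)
  then show ?thesis by simp
qed

text \<open>Inside an edge, \<open>F\<close> is extended by the lower envelope of the two lines of
  slope 1 and -1 that start from the values at the ends. The hypothesis on \<open>F\<close> is
  exactly what makes this envelope agree with \<open>F\<close> at both ends.\<close>

lemma vertex_potential:
  fixes F :: "'v \<Rightarrow> real"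
  assumes F: "\<And>e. e \<in> arcs G \<Longrightarrow> \<bar>F (tail G e) - F (head G e)\<bar> \<le> len e"
    and uv: "u \<in> verts G" "v \<in> verts G"
  shows "F v \<le> F u + d (Vertex u) (Vertex v)"
proof -
  define F' where "F' p = (case p of Vertex v \<Rightarrow> F v
    | Inner e t \<Rightarrow> min (F (tail G e) + t) (F (head G e) + len e - t))" for p
  have eq: "F' (ep e t) = min (F (tail G e) + t) (F (head G e) + len e - t)"
    if "e \<in> arcs G" "t \<in> {0..len e}" for e t
    using that F[OF that(1)] by (cases rule: edge_point_cases) (auto simp: F'_def)
  have "F' (Vertex v) \<le> F' (Vertex u) + d (Vertex u) (Vertex v)"
    using uv by (intro Lipschitz_potential) (auto simp: eq)
  then show ?thesis by (simp add: F'_def)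
qed

text \<open>Near an interior point the space looks like an interval. Both the separation of points
  and completeness rest on this.\<close>

lemma near_Inner:
  assumes y: "Inner e t \<in> X" and x: "x \<in> X" "d x (Inner e t) < min t (len e - t)"
  obtains s where "x = Inner e s" "\<bar>s - t\<bar> \<le> d x (Inner e t)"
proof -
  define r where "r = min t (len e - t)"
  \<comment> \<open>a tent function around \<open>Inner e t\<close> that vanishes off the interior of \<open>e\<close>\<close>
  define F where "F p = (case p of Vertex v \<Rightarrow> 0
    | Inner e' s \<Rightarrow> if e' = e then max 0 (r - \<bar>s - t\<bar>) else 0)" for p :: "('v, 'e) graph_point"
  have eq: "F (ep e' s) = (if e' = e then max 0 (r - \<bar>s - t\<bar>) else 0)"
    if "e' \<in> arcs G" "s \<in> {0..len e'}" for e' s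
    using that by (cases rule: edge_point_cases) (auto simp: F_def r_def)
  have "F (Inner e t) \<le> F x + d x (Inner e t)"
    using x y by (intro Lipschitz_potential) (auto simp: eq)
  moreover have "F (Inner e t) = r"
    using y by (simp add: F_def r_def)
  ultimately have "F x \<ge> r - d x (Inner e t)" "F x > 0"
    using x by (auto simp: r_def)
  then show ?thesis
    using that by (cases x) (auto simp: F_def split: if_splits)
qed

text \<open>The potential that is 0 at \<open>u\<close> and \<open>\<delta>\<close> at all other
  vertices changes by at most \<open>\<delta>\<close> along any edge.\<close>

lemma dist_Vertex_ge:
  assumes "u \<in> verts G" "v \<in> verts G" "u \<noteq> v"
  shows "\<delta> \<le> d (Vertex u) (Vertex v)"
proof -
  have "(if v = u then 0 else \<delta>) \<le> (if u = u then 0 else \<delta>) + d (Vertex u) (Vertex v)"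
    using delta_pos delta_le len_pos
    by (intro vertex_potential[where F = "\<lambda>v. if v = u then 0 else \<delta>"] assms(1,2)) (simp add: less_imp_le)
  then show ?thesis using assms by simp
qed

lemma dist_zero:
  assumes "x \<in> X" "y \<in> X" "d x y = 0"
  shows "x = y"
proof -
  have *: "x = Inner e t" if A: "x \<in> X" "Inner e t \<in> X" "d x (Inner e t) = 0" for x e t
  proof -
    have "d x (Inner e t) < min t (len e - t)" using A by simp
    then obtain s where "x = Inner e s" "\<bar>s - t\<bar> \<le> d x (Inner e t)"
      by (rule near_Inner[OF A(2,1)])
    then show ?thesis using A(3) by simp
  qed
  show ?thesis
  proof (cases x)
    case (Inner e t)
    have "d y x = 0" using assms(3) by (subst dist_commute)
    then show ?thesis using *[of y e t] assms(1,2) Inner by simp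
  next
    case (Vertex u)
    show ?thesis
    proof (cases y)
      case (Inner e t)
      then show ?thesis using *[of x e t] assms by simp
    next
      case (Vertex v)
      then show ?thesis
        using \<open>x = Vertex u\<close> dist_Vertex_ge[of u v] assms delta_pos by (cases "u = v") simp_all
    qed
  qed
qed

sublocale Metric_space X d
proof
  show "d x y = 0 \<longleftrightarrow> x = y" if "x \<in> X" "y \<in> X" for x y
    using dist_zero[OF that] dist_self that by blast
qed (use dist_nonneg dist_commute dist_triangle in blast)+

text \<open>A path that starts off the closed edge must enter it through one of its ends and then
  still has to reach the parameter \<open>t\<close>. Stating the bound with the distance to that
  end, not with the length of an initial piece, lets it pass through the induction.\<close>

lemma endpoint_split:
  assumes path: "pl_path G len x y l" and y: "y = ep e t" and e: "e \<in> arcs G" "t \<in> {0..len e}"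
    and x: "\<And>s. s \<in> {0..len e} \<Longrightarrow> x \<noteq> ep e s"
  shows "d x (Vertex (tail G e)) + t \<le> l \<or> d x (Vertex (head G e)) + len e - t \<le> l"
  using path y e x
proof (induction arbitrary: e t rule: pl_path.induct)
  case (refl x)
  then show ?case by blast
next
  case (step x e' s' l t' e t)
  have *: "d x (ep e' t') \<le> l + \<bar>s' - t'\<bar>"
    using pl_path.step[OF step(1-4)] by (rule dist_le)
  show ?case
  proof (cases rule: edge_point_cases[OF step.prems(2,3)])
    \<comment> \<open>An interior point determines its edge and parameter, so the last segment lies
      in \<open>e\<close> and the induction hypothesis applies at its start \<open>s'\<close>. When
      the path stops at an end of \<open>e\<close>, the bound \<open>*\<close> is the claim
      itself.\<close>
    case 3
    then have "e' = e" "t' = t"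
      using step.hyps step.prems(1) by (auto elim: edge_point_cases)
    then have "d x (Vertex (tail G e)) + s' \<le> l \<or> d x (Vertex (head G e)) + len e - s' \<le> l"
      using step by (intro step.IH) auto
    then show ?thesis using \<open>t' = t\<close> by auto
  qed (use * step.prems(1) in auto)
qed

lemma dist_edge_point:
  assumes "x \<in> X" "e \<in> arcs G" "t \<in> {0..len e}" "\<And>s. s \<in> {0..len e} \<Longrightarrow> x \<noteq> ep e s"
  shows "d x (ep e t) = min (d x (Vertex (tail G e)) + t) (d x (Vertex (head G e)) + len e - t)"
    (is "_ = min ?a ?b")
proof (rule antisym)
  have "d x (ep e t) \<le> d x (ep e s) + \<bar>s - t\<bar>" if "s \<in> {0..len e}" for s
    using triangle[OF assms(1) edge_point_in[OF assms(2)] edge_point_in[OF assms(2)], of t s]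
      dist_edge_le[OF assms(2) that assms(3)] by linarith
  from this[of 0] this[of "len e"] show "d x (ep e t) \<le> min ?a ?b"
    using assms len_pos[OF assms(2)] by (simp add: edge_point_0 edge_point_len)
  show "min ?a ?b \<le> d x (ep e t)"
    using endpoint_split[OF _ HOL.refl assms(2-4)] assms(1,2)
    by (intro dist_greatest) (auto simp: edge_point_in min_le_iff_disj)
qed

text \<open>Parametrisation by arc length. The Lipschitz bound will give both continuity and the
  upper bound on the length of the curve.\<close>

lemma pl_path_curve:
  assumes "pl_path G len x y l"
  shows "\<exists>g. g 0 = x \<and> g l = y \<and> g ` {0..l} \<subseteq> X \<and> (\<forall>s\<in>{0..l}. \<forall>t\<in>{0..l}. d (g s) (g t) \<le> \<bar>s - t\<bar>)"
  using assms
proof (induction rule: pl_path.induct)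
  case (refl x)
  then show ?case by (intro exI[of _ "\<lambda>_. x"]) auto
next
  case (step x e s l t)
  then obtain g where g: "g 0 = x" "g l = ep e s" "g ` {0..l} \<subseteq> X"
      "\<And>a b. a \<in> {0..l} \<Longrightarrow> b \<in> {0..l} \<Longrightarrow> d (g a) (g b) \<le> \<bar>a - b\<bar>"
    by blast
  define m where "m = \<bar>s - t\<bar>"
  \<comment> \<open>Unit speed motion along the last edge from \<open>s\<close> to \<open>t\<close>,
    in either direction, starting at time \<open>l\<close>.\<close>
  define p where "p a = (if s \<le> t then s + (a - l) else s - (a - l))" for a
  define h where "h a = (if a \<le> l then g a else ep e (p a))" for a
  have l: "l \<ge> 0" using step.hyps by (auto dest: pl_path_in)
  have p: "p a \<in> {0..len e}" if "a \<in> {l..l+m}" for a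
    using that step.hyps by (auto simp: p_def m_def)
  have h: "h a = ep e (p a)" if "a \<ge> l" for a
    using that g(2) by (auto simp: h_def p_def)
  have inX: "h a \<in> X" if "a \<in> {0..l+m}" for a
    using that g(3) edge_point_in[OF step.hyps(2)] by (auto simp: h_def)
  have right: "d (h a) (h b) \<le> b - a" if "l \<le> a" "a \<le> b" "b \<le> l + m" for a b
  proof -
    have "d (h a) (h b) \<le> \<bar>p a - p b\<bar>"
      using that h p by (auto intro!: dist_edge_le step.hyps)
    also have "\<dots> = b - a" using that by (auto simp: p_def)
    finally show ?thesis .
  qed
  have left: "d (h a) (h b) \<le> b - a" if "0 \<le> a" "a \<le> b" "b \<le> l" for a b
    using g(4)[of a b] that by (auto simp: h_def)
  \<comment> \<open>Times on different sides of \<open>l\<close> are compared through the junction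
    \<open>h l\<close>.\<close>
  have main: "d (h a) (h b) \<le> b - a" if "0 \<le> a" "a \<le> b" "b \<le> l + m" for a b
  proof -
    consider "b \<le> l" | "l \<le> a" | "a \<le> l" "l \<le> b" by linarith
    then show ?thesis
    proof cases
      case 3
      have "d (h a) (h b) \<le> d (h a) (h l) + d (h l) (h b)"
        using that 3 l by (intro triangle inX) auto
      then show ?thesis using left[of a l] right[of l b] that 3 l by auto
    qed (use left right that in auto)
  qed
  have "d (h a) (h b) \<le> \<bar>a - b\<bar>" if "a \<in> {0..l+m}" "b \<in> {0..l+m}" for a b
    using main[of a b] main[of b a] that dist_commute[of "h a" "h b"] by (cases "a \<le> b") auto
  moreover have "h 0 = x" using l g(1) by (simp add: h_def)
  moreover have "h (l + m) = ep e t" using h[of "l+m"] by (auto simp: m_def p_def)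
  ultimately show ?case using inX by (intro exI[of _ h]) (auto simp: m_def)
qed

section \<open>Completeness\<close>

lemma near_vertex:
  assumes "x \<in> X"
  shows "\<exists>v\<in>verts G. d x (Vertex v) \<le> (case x of Vertex v \<Rightarrow> 0 | Inner e t \<Rightarrow> min t (len e - t))"
proof (cases x)
  case (Vertex v)
  then show ?thesis using assms dist_self[OF assms] by (auto intro!: bexI[of _ v])
next
  case (Inner e t)
  then have e: "e \<in> arcs G" "0 < t" "t < len e" using assms by auto
  then have "d (ep e t) (ep e 0) \<le> t" "d (ep e t) (ep e (len e)) \<le> len e - t"
    using dist_edge_le[OF e(1), of t 0] dist_edge_le[OF e(1), of t "len e"] by auto
  then have "d x (Vertex (tail G e)) \<le> t" "d x (Vertex (head G e)) \<le> len e - t"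
    using e Inner by (simp_all add: edge_point_0 edge_point_len edge_point_Inner)
  then show ?thesis
    using tail_vertex[OF e(1)] head_vertex[OF e(1)] Inner by (auto simp: min_def)
qed

lemma complete: mcomplete
  unfolding mcomplete_def
proof (intro allI impI)
  fix \<sigma> assume \<sigma>: "MCauchy \<sigma>"
  then have inX: "\<sigma> n \<in> X" for n by (auto simp: MCauchy_def)
  have Cauchy: "\<exists>N. \<forall>n\<ge>N. \<forall>m\<ge>N. d (\<sigma> n) (\<sigma> m) < \<epsilon>" if "\<epsilon> > 0" for \<epsilon>
  proof -
    have "\<exists>N. \<forall>n n'. N \<le> n \<longrightarrow> N \<le> n' \<longrightarrow> d (\<sigma> n) (\<sigma> n') < \<epsilon>"
      by (rule mp[OF spec[OF conjunct2[OF \<sigma>[unfolded MCauchy_def]]] that])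
    then show ?thesis by simp
  qed
  \<comment> \<open>The distance along the edge to its nearer end. The proof splits according to
    whether it becomes arbitrarily small along the sequence or is eventually bounded away from
    0.\<close>
  define \<rho> where "\<rho> x = (case x of Vertex v \<Rightarrow> 0 | Inner e t \<Rightarrow> min t (len e - t))"
    for x :: "('v, 'e) graph_point"
  show "\<exists>x. limitin mtopology \<sigma> x sequentially"
  proof (cases "\<forall>r>0. \<forall>N. \<exists>n\<ge>N. \<rho> (\<sigma> n) < r")
    case True
    \<comment> \<open>the sequence comes arbitrarily close to the \<open>\<delta>\<close>-separated vertex set\<close>
    have vertex: "\<exists>n\<ge>N. \<exists>v\<in>verts G. d (\<sigma> n) (Vertex v) < r" if "r > 0" for r N
    proof -
      obtain n where n: "n \<ge> N" "\<rho> (\<sigma> n) < r" using True \<open>r > 0\<close> by blast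
      obtain v where "v \<in> verts G" "d (\<sigma> n) (Vertex v) \<le> \<rho> (\<sigma> n)"
        using near_vertex[OF inX[of n]] unfolding \<rho>_def by blast
      with n show ?thesis by (intro exI[of _ n] conjI bexI[of _ v]) auto
    qed
    have \<delta>4: "\<delta>/4 > 0" using delta_pos by simp
    obtain N where N: "\<forall>n\<ge>N. \<forall>m\<ge>N. d (\<sigma> n) (\<sigma> m) < \<delta>/4"
      using Cauchy[OF \<delta>4] by blast
    obtain k v where k: "k \<ge> N" "v \<in> verts G" "d (\<sigma> k) (Vertex v) < \<delta>/4"
      using vertex[OF \<delta>4, of N] by blast
    have "\<exists>M. \<forall>n\<ge>M. d (\<sigma> n) (Vertex v) < \<epsilon>" if "\<epsilon> > 0" for \<epsilon>
    proof -
      \<comment> \<open>\<open>\<epsilon>/2\<close> serves the convergence;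
        \<open>\<delta>/4\<close> ensures that the vertex \<open>w\<close> found at this scale is
        less than \<open>\<delta>\<close> from \<open>v\<close> and hence equal to it.\<close>
      define \<eta> where "\<eta> = min (\<epsilon>/2) (\<delta>/4)"
      have \<eta>: "\<eta> > 0" "\<eta> \<le> \<epsilon>/2" "\<eta> \<le> \<delta>/4" using that delta_pos by (auto simp: \<eta>_def)
      obtain M where M: "\<forall>n\<ge>M. \<forall>m\<ge>M. d (\<sigma> n) (\<sigma> m) < \<eta>"
        using Cauchy[OF \<eta>(1)] by blast
      obtain m w where m: "m \<ge> max M N" "w \<in> verts G" "d (\<sigma> m) (Vertex w) < \<eta>"
        using vertex[OF \<eta>(1), of "max M N"] by blast
      have km: "d (\<sigma> k) (\<sigma> m) < \<delta>/4" using N k(1) m(1) by simp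
      have "d (Vertex v) (Vertex w) \<le> d (Vertex v) (\<sigma> k) + (d (\<sigma> k) (\<sigma> m) + d (\<sigma> m) (Vertex w))"
        using dist_triangle[of "Vertex v" "\<sigma> k" "Vertex w"] dist_triangle[of "\<sigma> k" "\<sigma> m" "Vertex w"]
          inX[of k] inX[of m] k(2) m(2) by simp
      also have "\<dots> < \<delta>"
        using delta_pos k(3) m(3) km \<eta>(3) dist_commute[of "\<sigma> k" "Vertex v"] by linarith
      finally have "v = w" using dist_Vertex_ge[OF k(2) m(2)] by linarith
      have "d (\<sigma> n) (Vertex v) < \<epsilon>" if "n \<ge> M" for n
      proof -
        have "d (\<sigma> n) (\<sigma> m) < \<eta>" using M m(1) that by simp
        moreover have "d (\<sigma> n) (Vertex v) \<le> d (\<sigma> n) (\<sigma> m) + d (\<sigma> m) (Vertex v)"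
          using inX k(2) by (intro dist_triangle) auto
        ultimately show ?thesis using m(3) \<eta>(2) unfolding \<open>v = w\<close> by linarith
      qed
      then show ?thesis by blast
    qed
    then have "limitin mtopology \<sigma> (Vertex v) sequentially"
      using k(2) inX by (simp add: limit_metric_sequentially)
    then show ?thesis by blast
  next
    case False
    \<comment> \<open>the sequence is eventually confined to the interior of a single edge\<close>
    then obtain r N where r: "r > 0" "\<And>n. n \<ge> N \<Longrightarrow> \<rho> (\<sigma> n) \<ge> r"
      by (meson not_le)
    obtain N' where N': "\<forall>n\<ge>N'. \<forall>m\<ge>N'. d (\<sigma> n) (\<sigma> m) < r"
      using Cauchy[OF r(1)] by blast
    define M where "M = max N N'"
    obtain e t\<^sub>0 where M: "\<sigma> M = Inner e t\<^sub>0"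
      using r(2)[of M] r(1) by (cases "\<sigma> M") (auto simp: \<rho>_def M_def)
    \<comment> \<open>From \<open>M\<close> on, terms are closer to each other than
      \<open>r\<close>, while each is at least \<open>r\<close> away from the ends of its edge as
      measured along the edge. So \<open>near_Inner\<close> keeps them all on one edge.\<close>
    have near: "\<exists>s. \<sigma> n = Inner e' s \<and> \<bar>s - t\<bar> \<le> d (\<sigma> n) (\<sigma> m)"
      if A: "n \<ge> M" "m \<ge> M" "\<sigma> m = Inner e' t" for n m e' t
    proof -
      have "d (\<sigma> n) (\<sigma> m) < r" "\<rho> (\<sigma> m) \<ge> r"
        using N' r(2) A(1,2) by (simp_all add: M_def)
      then have "d (\<sigma> n) (Inner e' t) < min t (len e' - t)"
        unfolding A(3) \<rho>_def by simp
      then obtain s where "\<sigma> n = Inner e' s" "\<bar>s - t\<bar> \<le> d (\<sigma> n) (Inner e' t)"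
        by (rule near_Inner[OF inX[of m, unfolded A(3)] inX[of n]])
      then show ?thesis using A(3) by simp
    qed
    have "\<forall>n. \<exists>s. \<sigma> (n + M) = Inner e s"
      using near[OF _ _ M] by (metis le_add2 order_refl)
    then obtain \<tau> where \<tau>: "\<And>n. \<sigma> (n + M) = Inner e (\<tau> n)" by metis
    have e: "e \<in> arcs G" and \<tau>_in: "\<tau> n \<in> {0..len e}" for n
      using inX[of "n + M"] by (auto simp: \<tau>)
    have \<tau>_dist: "\<bar>\<tau> n - \<tau> m\<bar> \<le> d (\<sigma> (n + M)) (\<sigma> (m + M))" for n m
      using near[OF _ _ \<tau>, of "n + M" m] \<tau>[of n] by auto
    have "Cauchy \<tau>"
      unfolding Cauchy_def
    proof (intro allI impI)
      fix \<epsilon> :: real assume "\<epsilon> > 0"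
      then obtain K where K: "\<forall>n\<ge>K. \<forall>m\<ge>K. d (\<sigma> n) (\<sigma> m) < \<epsilon>" using Cauchy by blast
      have "dist (\<tau> m) (\<tau> n) < \<epsilon>" if "m \<ge> K" "n \<ge> K" for m n
      proof -
        have "d (\<sigma> (m + M)) (\<sigma> (n + M)) < \<epsilon>" using K that by simp
        then show ?thesis using \<tau>_dist[of m n] unfolding dist_real_def by linarith
      qed
      then show "\<exists>M. \<forall>m\<ge>M. \<forall>n\<ge>M. dist (\<tau> m) (\<tau> n) < \<epsilon>" by blast
    qed
    then obtain t where t: "\<tau> \<longlonglongrightarrow> t"
      using Cauchy_convergent convergent_def by blast
    have t_in: "t \<in> {0..len e}"
      by (rule closed_sequentially[OF closed_atLeastAtMost _ t]) (use \<tau>_in in auto)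
    have "\<exists>K. \<forall>n\<ge>K. d (\<sigma> n) (ep e t) < \<epsilon>" if "\<epsilon> > 0" for \<epsilon>
    proof -
      obtain K where K: "\<And>n. n \<ge> K \<Longrightarrow> \<bar>\<tau> n - t\<bar> < \<epsilon>"
        using LIMSEQ_D[OF t \<open>\<epsilon> > 0\<close>] unfolding real_norm_def by blast
      have "d (\<sigma> n) (ep e t) < \<epsilon>" if "n \<ge> K + M" for n
      proof -
        have "\<sigma> n = ep e (\<tau> (n - M))"
          using \<tau>[of "n - M"] inX[of n] that by (simp add: edge_point_Inner)
        then have "d (\<sigma> n) (ep e t) \<le> \<bar>\<tau> (n - M) - t\<bar>"
          using dist_edge_le[OF e \<tau>_in t_in] by simp
        then show ?thesis using K[of "n - M"] that by linarith
      qed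
      then show ?thesis by blast
    qed
    then have "limitin mtopology \<sigma> (ep e t) sequentially"
      using inX edge_point_in[OF e] by (simp add: limit_metric_sequentially)
    then show ?thesis by blast
  qed
qed

text \<open>A curve is at least as long as its two-point subdivision. Conversely, an almost shortest
  piecewise linear path, rescaled to the unit interval, is a curve at most as long as the path; the
  infimum need not be attained, hence the \<open>\<epsilon>\<close>.\<close>

lemma path_metric_space: "path_metric_space X d"
  unfolding path_metric_space_def
proof (intro conjI ballI antisym)
  show "Metric_space X d" ..
  fix x y assume xy: "x \<in> X" "y \<in> X"
  let ?C = "{g. pathin mtopology g \<and> g 0 = x \<and> g 1 = y}"
  show "ereal (d x y) \<le> (INF g\<in>?C. curve_length d g)"
    by (rule INF_greatest) (use dist_le_curve_length in blast)
  show "(INF g\<in>?C. curve_length d g) \<le> ereal (d x y)"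
  proof (rule ereal_le_epsilon2)
    fix \<epsilon> :: real assume "\<epsilon> > 0"
    then obtain l where l: "pl_path G len x y l" "l < d x y + \<epsilon>"
      using dist_approx[OF xy, of "d x y + \<epsilon>"] by auto
    obtain g where g: "g 0 = x" "g l = y" "g ` {0..l} \<subseteq> X"
        "\<forall>s\<in>{0..l}. \<forall>t\<in>{0..l}. d (g s) (g t) \<le> \<bar>s - t\<bar>"
      using pl_path_curve[OF l(1)] by blast
    have l0: "l \<ge> 0" by (rule pl_path_in(3)[OF l(1)])
    define h where "h t = g (l * t)" for t
    have scale: "l * t \<in> {0..l}" if "t \<in> {0..1}" for t
      using that l0 mult_left_le[of t l] by auto
    have h_in: "h t \<in> X" if "t \<in> {0..1}" for t
      using scale[OF that] g(3) by (auto simp: h_def)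
    have Lip: "d (h s) (h t) \<le> l * \<bar>s - t\<bar>" if "s \<in> {0..1}" "t \<in> {0..1}" for s t
    proof -
      have "d (h s) (h t) \<le> \<bar>l * s - l * t\<bar>"
        unfolding h_def using g(4) scale[OF that(1)] scale[OF that(2)] by blast
      also have "\<dots> = l * \<bar>s - t\<bar>"
        using l0 by (simp add: abs_mult flip: right_diff_distrib)
      finally show ?thesis .
    qed
    have "pathin mtopology h"
      by (rule pathin_Lipschitz) (rule h_in Lip; assumption)+
    then have "h \<in> ?C"
      using g(1,2) by (simp add: h_def[of 0] h_def[of 1])
    then have "(INF g\<in>?C. curve_length d g) \<le> curve_length d h"
      by (rule INF_lower)
    also have "\<dots> \<le> ereal l"
      by (rule curve_length_Lipschitz[OF l0]) (rule Lip)
    also have "\<dots> \<le> ereal (d x y) + ereal \<epsilon>"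
      using l(2) by simp
    finally show "(INF g\<in>?C. curve_length d g) \<le> ereal (d x y) + ereal \<epsilon>" .
  qed
qed

section \<open>Reducing betweenness of points to betweenness of vertices\<close>

lemma dist_via_endpoint:
  assumes xy: "x \<in> X" "Inner e t \<in> X" and far: "d x (Inner e t) > len e"
  shows "d x (Inner e t) = min (d x (Vertex (tail G e)) + t) (d x (Vertex (head G e)) + len e - t)"
proof -
  have e: "e \<in> arcs G" "0 < t" "t < len e" using xy by auto
  \<comment> \<open>Any point of the closed edge is within \<open>len e\<close> of
    \<open>Inner e t\<close>, so \<open>far\<close> puts \<open>x\<close> off this edge.\<close>
  have "x \<noteq> ep e s" if "s \<in> {0..len e}" for s
    using dist_edge_le[OF e(1) that, of t] that far e by (auto simp: edge_point_Inner)
  then show ?thesis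
    using dist_edge_point[OF xy(1) e(1), of t] e by (simp add: edge_point_Inner)
qed

lemma dist_Inner_tail: "Inner e t \<in> X \<Longrightarrow> d (Vertex (tail G e)) (Inner e t) \<le> t"
  using dist_edge_le[of e 0 t] by (simp add: edge_point_0 edge_point_Inner)

lemma dist_Inner_head: "Inner e t \<in> X \<Longrightarrow> d (Vertex (head G e)) (Inner e t) \<le> len e - t"
  using dist_edge_le[of e "len e" t] by (simp add: edge_point_len edge_point_Inner)

context
  fixes L :: real
  assumes len_le: "\<And>e. e \<in> arcs G \<Longrightarrow> len e \<le> L" and L_nonneg: "L \<ge> 0"
begin

text \<open>Even where no shortest path exists, a last vertex before \<open>y\<close> can be chosen
  without loss, since only the two ends of the edge containing \<open>y\<close> compete.\<close>

lemma geodesic_through_vertex: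
  assumes xy: "x \<in> X" "y \<in> X" and far: "d x y > L"
  obtains v where "v \<in> verts G" "d x y = d x (Vertex v) + d (Vertex v) y" "d (Vertex v) y \<le> L"
proof (cases y)
  case (Vertex v)
  then show ?thesis using that[of v] xy dist_self L_nonneg by simp
next
  case (Inner e t)
  then have e: "e \<in> arcs G" "0 < t" "t < len e" using xy by auto
  have *: "d x y = min (d x (Vertex (tail G e)) + t) (d x (Vertex (head G e)) + len e - t)"
    using dist_via_endpoint[of x e t] xy far len_le[OF e(1)] Inner by simp
  have tri: "d x y \<le> d x (Vertex v) + d (Vertex v) y" if "v \<in> verts G" for v
    using xy that by (intro dist_triangle) auto
  show ?thesis
  proof (cases "d x y = d x (Vertex (tail G e)) + t")
    case True
    then show ?thesis
      using that[OF tail_vertex[OF e(1)]] tri[OF tail_vertex[OF e(1)]] dist_Inner_tail[of e t]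
        len_le[OF e(1)] e Inner xy by fastforce
  next
    case False
    then have "d x y = d x (Vertex (head G e)) + (len e - t)" using * by linarith
    then show ?thesis
      using that[OF head_vertex[OF e(1)]] tri[OF head_vertex[OF e(1)]] dist_Inner_head[of e t]
        len_le[OF e(1)] e Inner xy by fastforce
  qed
qed

text \<open>Suppose \<open>y\<close> is interior to an edge and far from \<open>u\<close> and
  \<open>w\<close>. If the distances from both were realised through the same end, going straight
  through that end would be strictly shorter than passing \<open>y\<close>. So they use opposite
  ends, and then the tail vertex also lies between \<open>u\<close> and \<open>w\<close>; the
  hypothesis on vertices applies to it at the cost of one edge length.\<close>

lemma between_vertices:
  assumes vertices: "\<And>u v w. u \<in> verts G \<Longrightarrow> v \<in> verts G \<Longrightarrow> w \<in> verts G \<Longrightarrow>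
      d (Vertex u) (Vertex w) = d (Vertex u) (Vertex v) + d (Vertex v) (Vertex w) \<Longrightarrow>
      d (Vertex u) (Vertex v) \<le> D \<or> d (Vertex v) (Vertex w) \<le> D"
    and D: "D \<ge> 0"
    and u: "u \<in> verts G" and w: "w \<in> verts G" and y: "y \<in> X"
    and between: "d (Vertex u) (Vertex w) = d (Vertex u) y + d y (Vertex w)"
  shows "d (Vertex u) y \<le> D + L \<or> d y (Vertex w) \<le> D + L"
proof (cases y)
  case (Vertex v)
  then show ?thesis using vertices[of u v w] u w y between L_nonneg by fastforce
next
  case (Inner e t)
  then have e: "e \<in> arcs G" "0 < t" "t < len e" using y by auto
  let ?a = "Vertex (tail G e)" and ?b = "Vertex (head G e)"
  let ?u = "Vertex u" and ?w = "Vertex w"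
  have in_X: "?a \<in> X" "?b \<in> X" "?u \<in> X" "?w \<in> X"
    using tail_vertex[OF e(1)] head_vertex[OF e(1)] u w by auto
  have L: "len e \<le> L" by (rule len_le[OF e(1)])
  show ?thesis
  proof (rule ccontr)
    assume "\<not> ?thesis"
    then have far: "d ?u y > D + L" "d ?w y > D + L" by (auto simp: dist_commute)
    have u_min: "d ?u y = min (d ?u ?a + t) (d ?u ?b + len e - t)"
      using dist_via_endpoint[of ?u e t] in_X y far D L Inner by simp
    have w_min: "d ?w y = min (d ?w ?a + t) (d ?w ?b + len e - t)"
      using dist_via_endpoint[of ?w e t] in_X y far D L Inner by simp
    have tri: "d ?u ?w \<le> d ?u ?a + d ?w ?a" "d ?u ?w \<le> d ?u ?b + d ?w ?b"
      using dist_triangle[of ?u ?a ?w] dist_triangle[of ?u ?b ?w] in_X dist_commute by metis+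
    have ab: "d ?a ?b \<le> len e"
      using dist_edge_le[OF e(1), of 0 "len e"] e by (simp add: edge_point_0 edge_point_len)
    have via: "d ?w ?a \<le> d ?w ?b + len e" "d ?u ?a \<le> d ?u ?b + len e"
      using dist_triangle[of ?w ?b ?a] dist_triangle[of ?u ?b ?a] in_X ab dist_commute[of ?a ?b] by auto
    have btw: "d ?u ?w = d ?u y + d ?w y"
      using between dist_commute[of y ?w] by simp
    have comm: "d ?a ?w = d ?w ?a" by (rule dist_commute)
    consider "d ?u y = d ?u ?a + t" "d ?w y = d ?w ?a + t"
      | "d ?u y = d ?u ?b + len e - t" "d ?w y = d ?w ?b + len e - t"
      | "d ?u y = d ?u ?a + t" "d ?w y = d ?w ?b + len e - t"
      | "d ?u y = d ?u ?b + len e - t" "d ?w y = d ?w ?a + t"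
      using u_min w_min by linarith
    then show False
    proof cases
      case 3
      then have "d ?u ?w = d ?u ?a + d ?w ?a" using tri via btw by linarith
      then have "d ?u ?a \<le> D \<or> d ?w ?a \<le> D"
        using vertices[of u "tail G e" w] u w tail_vertex[OF e(1)] comm by simp
      moreover have "d ?w y \<le> d ?w ?a + t" using w_min by linarith
      ultimately show False using 3 far L e by linarith
    next
      case 4
      then have "d ?u ?w = d ?u ?a + d ?w ?a" using tri via btw by linarith
      then have "d ?u ?a \<le> D \<or> d ?w ?a \<le> D"
        using vertices[of u "tail G e" w] u w tail_vertex[OF e(1)] comm by simp
      moreover have "d ?u y \<le> d ?u ?a + t" using u_min by linarith
      ultimately show False using 4 far L e by linarith
    qed (use tri btw e in linarith)+
  qed
qed

text \<open>The outer points are replaced by vertices \<open>u\<close> and \<open>w\<close> lying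
  between them and \<open>y\<close>. Since \<open>y\<close> is between \<open>x\<close> and
  \<open>z\<close>, all triangle inequalities along \<open>x\<close>, \<open>u\<close>,
  \<open>y\<close>, \<open>w\<close>, \<open>z\<close> are tight, so \<open>y\<close> is between
  \<open>u\<close> and \<open>w\<close>. This replacement loses at most \<open>L\<close> on either
  side, on top of the loss in \<open>between_vertices\<close>.\<close>

lemma between_points:
  assumes vertices: "\<And>u v w. u \<in> verts G \<Longrightarrow> v \<in> verts G \<Longrightarrow> w \<in> verts G \<Longrightarrow>
      d (Vertex u) (Vertex w) = d (Vertex u) (Vertex v) + d (Vertex v) (Vertex w) \<Longrightarrow>
      d (Vertex u) (Vertex v) \<le> D \<or> d (Vertex v) (Vertex w) \<le> D"
    and D: "D \<ge> 0"
    and xyz: "x \<in> X" "y \<in> X" "z \<in> X"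
    and between: "d x z = d x y + d y z"
  shows "d x y \<le> D + 2 * L \<or> d y z \<le> D + 2 * L"
proof (rule ccontr)
  assume "\<not> ?thesis"
  then have far: "d y x > D + 2 * L" "d y z > D + 2 * L" by (auto simp: dist_commute)
  then have "d y x > L" "d y z > L" using D L_nonneg by auto
  obtain u where u: "u \<in> verts G" "d y x = d y (Vertex u) + d (Vertex u) x" "d (Vertex u) x \<le> L"
    using geodesic_through_vertex[OF xyz(2,1) \<open>d y x > L\<close>] .
  obtain w where w: "w \<in> verts G" "d y z = d y (Vertex w) + d (Vertex w) z" "d (Vertex w) z \<le> L"
    using geodesic_through_vertex[OF xyz(2,3) \<open>d y z > L\<close>] .
  have "d x z \<le> d x (Vertex u) + d (Vertex u) z" "d (Vertex u) z \<le> d (Vertex u) (Vertex w) + d (Vertex w) z"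
    "d (Vertex u) (Vertex w) \<le> d (Vertex u) y + d y (Vertex w)"
    using xyz u(1) w(1) by (auto intro!: dist_triangle)
  then have "d (Vertex u) (Vertex w) = d (Vertex u) y + d y (Vertex w)"
    using between u(2) w(2) dist_commute[of y "Vertex u"] dist_commute[of x "Vertex u"]
      dist_commute[of x y] by linarith
  from between_vertices[OF _ D u(1) w(1) xyz(2) this]
  have "d (Vertex u) y \<le> D + L \<or> d y (Vertex w) \<le> D + L"
    using vertices by blast
  then show False
    using far u(2,3) w(2,3) dist_commute[of y "Vertex u"] by linarith
qed

end

end

section \<open>Degenerate triangles\<close>

lemma (in Metric_space) degenerate_triangles_boundedI:
  assumes *: "\<And>x y z. x \<in> M \<Longrightarrow> y \<in> M \<Longrightarrow> z \<in> M \<Longrightarrow> d x z = d x y + d y z \<Longrightarrow> d x y \<le> D \<or> d y z \<le> D"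
  shows "degenerate_triangles_bounded D M d"
  unfolding degenerate_triangles_bounded_def degenerate_sides_def
proof (intro ballI impI)
  fix x y z assume M: "x \<in> M" "y \<in> M" "z \<in> M"
    and deg: "d y z + d z x \<le> d x y \<or> d x y + d z x \<le> d y z \<or> d x y + d y z \<le> d z x"
  from deg consider "d x y = d x z + d z y" | "d y z = d y x + d x z" | "d x z = d x y + d y z"
    using triangle[OF M(1,3,2)] triangle[OF M(2,1,3)] triangle[OF M] commute[of x y] commute[of y z]
      commute[of x z] by linarith
  then show "d x y \<le> D \<or> d y z \<le> D \<or> d z x \<le> D"
    using *[OF M(1,3,2)] *[OF M(2,1,3)] *[OF M] commute[of x y] commute[of y z] commute[of x z]
    by cases auto
qed

text \<open>Squaring the equation gives the reverse Cauchy-Schwarz inequality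
  \<open>A * B \<le> P\<close>. Lagrange's identity then makes the two vectors parallel, and
  \<open>A * B = P\<close> leaves no slack in the bounds on the third pair.\<close>

lemma Minkowski_equality:
  fixes a\<^sub>1 a\<^sub>2 b\<^sub>1 b\<^sub>2 c\<^sub>1 c\<^sub>2 :: real
  assumes nonneg: "a\<^sub>1 \<ge> 0" "a\<^sub>2 \<ge> 0" "b\<^sub>1 \<ge> 0" "b\<^sub>2 \<ge> 0" "c\<^sub>1 \<ge> 0" "c\<^sub>2 \<ge> 0"
    and le: "c\<^sub>1 \<le> a\<^sub>1 + b\<^sub>1" "c\<^sub>2 \<le> a\<^sub>2 + b\<^sub>2"
    and eq: "sqrt (c\<^sub>1\<^sup>2 + c\<^sub>2\<^sup>2) = sqrt (a\<^sub>1\<^sup>2 + a\<^sub>2\<^sup>2) + sqrt (b\<^sub>1\<^sup>2 + b\<^sub>2\<^sup>2)"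
  shows "c\<^sub>1 = a\<^sub>1 + b\<^sub>1" "c\<^sub>2 = a\<^sub>2 + b\<^sub>2" "a\<^sub>1 * b\<^sub>2 = a\<^sub>2 * b\<^sub>1"
proof -
  define A B P where "A = sqrt (a\<^sub>1\<^sup>2 + a\<^sub>2\<^sup>2)" and "B = sqrt (b\<^sub>1\<^sup>2 + b\<^sub>2\<^sup>2)" and "P = a\<^sub>1 * b\<^sub>1 + a\<^sub>2 * b\<^sub>2"
  have A: "A \<ge> 0" "A\<^sup>2 = a\<^sub>1\<^sup>2 + a\<^sub>2\<^sup>2" and B: "B \<ge> 0" "B\<^sup>2 = b\<^sub>1\<^sup>2 + b\<^sub>2\<^sup>2"
    by (simp_all add: A_def B_def)
  have P: "P \<ge> 0" using nonneg by (simp add: P_def)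
  have "(A + B)\<^sup>2 = (sqrt (c\<^sub>1\<^sup>2 + c\<^sub>2\<^sup>2))\<^sup>2" unfolding eq A_def B_def ..
  then have sq: "c\<^sub>1\<^sup>2 + c\<^sub>2\<^sup>2 = A\<^sup>2 + B\<^sup>2 + 2 * (A * B)"
    by (simp add: power2_sum)
  have c: "c\<^sub>1\<^sup>2 \<le> (a\<^sub>1 + b\<^sub>1)\<^sup>2" "c\<^sub>2\<^sup>2 \<le> (a\<^sub>2 + b\<^sub>2)\<^sup>2"
    using nonneg le by (auto intro: power_mono)
  have sum: "(a\<^sub>1 + b\<^sub>1)\<^sup>2 + (a\<^sub>2 + b\<^sub>2)\<^sup>2 = A\<^sup>2 + B\<^sup>2 + 2 * P"
    unfolding A B P_def by (simp add: power2_sum algebra_simps)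
  have AB: "A * B \<le> P" using sq c sum by linarith
  have Lagrange: "(A * B)\<^sup>2 = P\<^sup>2 + (a\<^sub>1 * b\<^sub>2 - a\<^sub>2 * b\<^sub>1)\<^sup>2"
    unfolding power_mult_distrib A B P_def by (simp add: power2_eq_square algebra_simps)
  have "(A * B)\<^sup>2 \<le> P\<^sup>2" using AB A B by (intro power_mono) auto
  then have "(a\<^sub>1 * b\<^sub>2 - a\<^sub>2 * b\<^sub>1)\<^sup>2 \<le> 0" using Lagrange by linarith
  then show parallel: "a\<^sub>1 * b\<^sub>2 = a\<^sub>2 * b\<^sub>1" by simp
  have "(A * B)\<^sup>2 = P\<^sup>2" using Lagrange parallel by simp
  then have "A * B = P" using A B P by (simp add: power2_eq_iff_nonneg)
  \<comment> \<open>The sums of the two squares agree while each square is bounded by its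
    counterpart, so they agree one by one.\<close>
  then have "c\<^sub>1\<^sup>2 = (a\<^sub>1 + b\<^sub>1)\<^sup>2" "c\<^sub>2\<^sup>2 = (a\<^sub>2 + b\<^sub>2)\<^sup>2" using sq sum c by linarith+
  then show "c\<^sub>1 = a\<^sub>1 + b\<^sub>1" "c\<^sub>2 = a\<^sub>2 + b\<^sub>2"
    using nonneg by (simp_all add: power2_eq_iff_nonneg)
qed

lemma sqrt_sum_squares_le:
  fixes D :: real
  assumes "a \<ge> 0" "b \<ge> 0" "a \<le> D" "b \<le> D"
  shows "sqrt (a\<^sup>2 + b\<^sup>2) \<le> 2 * D"
  using sqrt_sum_squares_le_sum[of a b] assms by simp

text \<open>For the crossed case in the product, where one leg is short in the first factor and the
  other leg in the second: the common value of the cross products is at most \<open>D * D\<close>,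
  so the remaining two sides cannot both exceed \<open>D\<close>.\<close>

lemma parallel_bounded:
  fixes D :: real
  assumes nonneg: "a\<^sub>1 \<ge> 0" "a\<^sub>2 \<ge> 0" "b\<^sub>1 \<ge> 0" "b\<^sub>2 \<ge> 0"
    and parallel: "a\<^sub>1 * b\<^sub>2 = a\<^sub>2 * b\<^sub>1" and le: "a\<^sub>1 \<le> D" "b\<^sub>2 \<le> D"
  shows "a\<^sub>2 \<le> D \<or> b\<^sub>1 \<le> D"
proof (rule ccontr)
  assume "\<not> ?thesis"
  then have "a\<^sub>2 > D" "b\<^sub>1 > D" "D \<ge> 0" using nonneg le by auto
  then have "D * D < a\<^sub>2 * b\<^sub>1" by (intro mult_strict_mono') auto
  moreover have "a\<^sub>1 * b\<^sub>2 \<le> D * D" using nonneg le by (intro mult_mono) auto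
  ultimately show False using parallel by simp
qed

text \<open>Each factor has a short leg, and proportionality of the legs allows the same leg to be
  chosen in both factors. The factor 2 comes from bounding the Euclidean norm by the sum.\<close>

lemma (in Metric_space) degenerate_triangles_bounded_prod:
  assumes *: "\<And>x y z. x \<in> M \<Longrightarrow> y \<in> M \<Longrightarrow> z \<in> M \<Longrightarrow> d x z = d x y + d y z \<Longrightarrow> d x y \<le> D \<or> d y z \<le> D"
  shows "degenerate_triangles_bounded (2 * D) (M \<times> M) (prod_dist d d)"
proof -
  interpret MM: Metric_space12 M d M d ..
  show ?thesis
  proof (rule MM.Prod_metric.degenerate_triangles_boundedI)
    fix x y z assume M: "x \<in> M \<times> M" "y \<in> M \<times> M" "z \<in> M \<times> M"
      and eq: "prod_dist d d x z = prod_dist d d x y + prod_dist d d y z"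
    obtain x\<^sub>1 x\<^sub>2 y\<^sub>1 y\<^sub>2 z\<^sub>1 z\<^sub>2 where xyz: "x = (x\<^sub>1, x\<^sub>2)" "y = (y\<^sub>1, y\<^sub>2)" "z = (z\<^sub>1, z\<^sub>2)"
      by (cases x, cases y, cases z)
    have in1: "x\<^sub>1 \<in> M" "y\<^sub>1 \<in> M" "z\<^sub>1 \<in> M" and in2: "x\<^sub>2 \<in> M" "y\<^sub>2 \<in> M" "z\<^sub>2 \<in> M"
      using M xyz by auto
    have "d x\<^sub>1 z\<^sub>1 = d x\<^sub>1 y\<^sub>1 + d y\<^sub>1 z\<^sub>1" "d x\<^sub>2 z\<^sub>2 = d x\<^sub>2 y\<^sub>2 + d y\<^sub>2 z\<^sub>2"
      and parallel: "d x\<^sub>1 y\<^sub>1 * d y\<^sub>2 z\<^sub>2 = d x\<^sub>2 y\<^sub>2 * d y\<^sub>1 z\<^sub>1"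
      using Minkowski_equality[of "d x\<^sub>1 y\<^sub>1" "d x\<^sub>2 y\<^sub>2" "d y\<^sub>1 z\<^sub>1" "d y\<^sub>2 z\<^sub>2" "d x\<^sub>1 z\<^sub>1" "d x\<^sub>2 z\<^sub>2"]
        triangle[OF in1] triangle[OF in2] eq by (simp_all add: prod_dist_def xyz)
    then have or1: "d x\<^sub>1 y\<^sub>1 \<le> D \<or> d y\<^sub>1 z\<^sub>1 \<le> D" and or2: "d x\<^sub>2 y\<^sub>2 \<le> D \<or> d y\<^sub>2 z\<^sub>2 \<le> D"
      using *[OF in1] *[OF in2] by auto
    have "d x\<^sub>1 y\<^sub>1 \<le> D \<and> d x\<^sub>2 y\<^sub>2 \<le> D \<or> d y\<^sub>1 z\<^sub>1 \<le> D \<and> d y\<^sub>2 z\<^sub>2 \<le> D"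
      using or1 or2 parallel_bounded[OF nonneg nonneg nonneg nonneg parallel, of D]
        parallel_bounded[OF nonneg nonneg nonneg nonneg parallel[symmetric], of D] by blast
    then show "prod_dist d d x y \<le> 2 * D \<or> prod_dist d d y z \<le> 2 * D"
      unfolding xyz prod_dist_def by (auto intro: sqrt_sum_squares_le)
  qed
qed

text \<open>The missing boundary point is the degenerate triple \<open>(s, s, 2 * s)\<close>, all of
  whose entries exceed \<open>D\<close>.\<close>

lemma frontier_K3_not_subset:
  assumes "degenerate_triangles_bounded D M d"
  shows "\<not> frontier (K3 (UNIV :: (real ^ 2) set) dist) \<subseteq> K3 M d"
proof
  let ?K = "K3 (UNIV :: (real ^ 2) set) dist"
  define s where "s = max D 0 + 1"
  have s: "s > D" "s > 0" by (auto simp: s_def)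
  define e :: "real ^ 2" where "e = axis 1 1"
  have e: "norm e = 1" by (simp add: e_def norm_axis_1)
  have "(s, s, 2 * s) \<in> ?K"
    unfolding K3_def
  proof (intro CollectI exI conjI)
    have *: "dist (a *\<^sub>R e) (b *\<^sub>R e) = \<bar>a - b\<bar>" for a b
      using e by (simp add: dist_norm flip: scaleR_diff_left)
    show "(s, s, 2 * s) = (dist (0 *\<^sub>R e) (s *\<^sub>R e), dist (s *\<^sub>R e) ((2 * s) *\<^sub>R e),
        dist ((2 * s) *\<^sub>R e) (0 *\<^sub>R e))"
      unfolding * using s by simp
  qed auto
  moreover have "(s, s, 2 * s) \<notin> interior ?K"
  proof
    assume "(s, s, 2 * s) \<in> interior ?K"
    then obtain r where r: "r > 0" "ball (s, s, 2 * s) r \<subseteq> ?K"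
      by (auto simp: mem_interior)
    \<comment> \<open>Any increase of the third entry violates the triangle inequality, so no ball
      around the triple fits into the set.\<close>
    have "(s, s, 2 * s + r / 2) \<in> ball (s, s, 2 * s) r"
      using r(1) by (simp add: dist_Pair_Pair dist_real_def)
    then obtain x y z :: "real ^ 2"
      where "dist x y = s" "dist y z = s" "dist z x = 2 * s + r / 2"
      using r(2) by (auto simp: K3_def)
    then show False
      using dist_triangle[of z x y] dist_commute[of z y] dist_commute[of y x] r(1) by simp
  qed
  ultimately have "(s, s, 2 * s) \<in> frontier ?K"
    using closure_subset by (auto simp: frontier_def)
  moreover assume "frontier ?K \<subseteq> K3 M d"
  ultimately obtain x y z where "x \<in> M" "y \<in> M" "z \<in> M" "d x y = s" "d y z = s" "d z x = 2 * s"
    by (auto simp: K3_def)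
  then show False
    using assms s unfolding degenerate_triangles_bounded_def degenerate_sides_def by fastforce
qed

section \<open>The layered graph\<close>

text \<open>A vertex number codes a pair whose first component codes the layer; the free second
  component makes every layer infinite.\<close>

definition layer :: "nat \<Rightarrow> int" where
  "layer v = int_decode (fst (prod_decode v))"

text \<open>Computed from the whole vertex number: an infinite layer contains arbitrarily large
  numbers, so its weights come arbitrarily close to 0.\<close>

definition weight :: "nat \<Rightarrow> real" where
  "weight v = 1 / (real v + 1)"

definition layered_graph :: "(nat, nat) pre_digraph" where
  "layered_graph = \<lparr>verts = UNIV,
     arcs = {e. layer (snd (prod_decode e)) = layer (fst (prod_decode e)) + 1},
     tail = \<lambda>e. fst (prod_decode e), head = \<lambda>e. snd (prod_decode e)\<rparr>"

definition layered_len :: "nat \<Rightarrow> real" where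
  "layered_len e = 1 + weight (tail layered_graph e) + weight (head layered_graph e)"

lemma weight_pos: "weight v > 0" and weight_le_1: "weight v \<le> 1"
  by (auto simp: weight_def)

text \<open>The code of a pair is at least its second component, so a large second component makes
  the weight small. With 1 as the bound, this later serves merely to pick some vertex of a
  layer.\<close>

lemma ex_light_vertex:
  assumes "\<epsilon> > 0"
  obtains v where "layer v = i" "weight v < \<epsilon>"
proof -
  obtain n where n: "inverse (real (Suc n)) < \<epsilon>" using reals_Archimedean[OF assms] by blast
  define v where "v = prod_encode (int_encode i, n)"
  have "n \<le> v" by (simp add: v_def le_prod_encode_2)
  then have "weight v \<le> inverse (real (Suc n))"
    unfolding weight_def by (simp add: field_simps)
  then show ?thesis using that[of v] n by (simp add: v_def layer_def)
qed

lemma verts_layered: "v \<in> verts layered_graph"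
  by (simp add: layered_graph_def)

lemma arc_layer: "e \<in> arcs layered_graph \<Longrightarrow> layer (head layered_graph e) = layer (tail layered_graph e) + 1"
  by (simp add: layered_graph_def)

lemma ex_arc:
  assumes "layer v = layer u + 1"
  obtains e where "e \<in> arcs layered_graph" "tail layered_graph e = u" "head layered_graph e = v"
  using that[of "prod_encode (u, v)"] assms by (simp add: layered_graph_def)

lemma layered_len_bounds: "1 \<le> layered_len e" "layered_len e \<le> 3"
  using weight_pos[of "tail layered_graph e"] weight_pos[of "head layered_graph e"]
    weight_le_1[of "tail layered_graph e"] weight_le_1[of "head layered_graph e"]
  by (auto simp: layered_len_def)

text \<open>Different layers are joined by climbing one layer at a time; two vertices of the same
  layer are joined through the layer above.\<close>

lemma connected_layered_graph: "Digraph_Component.connected layered_graph"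
proof -
  define R where "R = parcs (mk_symmetric layered_graph)"
  have R: "(u, v) \<in> R" "(v, u) \<in> R" if "layer v = layer u + 1" for u v
    using ex_arc[OF that] by (auto simp: R_def parcs_mk_symmetric)
  have "sym R" by (auto simp: R_def parcs_mk_symmetric sym_def)
  then have sym: "(v, u) \<in> R\<^sup>*" if "(u, v) \<in> R\<^sup>*" for u v
    using that by (meson sym_rtrancl symD)
  have chain: "(u, v) \<in> R\<^sup>*" if "layer v = layer u + 1 + int n" for u v n
    using that
  proof (induction n arbitrary: v)
    case 0
    then show ?case using R(1) by auto
  next
    case (Suc n)
    obtain m where m: "layer m = layer u + 1 + int n" by (rule ex_light_vertex[of 1]) auto
    then have "(u, m) \<in> R\<^sup>*" "(m, v) \<in> R" using Suc R(1)[of v m] by auto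
    then show ?case by (rule rtrancl_into_rtrancl)
  qed
  have up: "(u, v) \<in> R\<^sup>*" if "layer u < layer v" for u v
    using chain[of v u "nat (layer v - layer u - 1)"] that by simp
  have "(u, v) \<in> R\<^sup>*" for u v
  proof -
    consider "layer u < layer v" | "layer v < layer u" | "layer u = layer v" by linarith
    then show ?thesis
    proof cases
      case 3
      obtain m where "layer m = layer u + 1" by (rule ex_light_vertex[of 1]) auto
      then have "(u, m) \<in> R\<^sup>*" "(m, v) \<in> R\<^sup>*" using 3 up[of u m] sym[OF up, of v m] by auto
      then show ?thesis by (rule rtrancl_trans)
    qed (auto intro: up sym)
  qed
  moreover have "rtrancl_on UNIV R = R\<^sup>*"
    by (auto intro: rtrancl_on_rtranclI rtrancl_consistent_rtrancl_on)
  ultimately show ?thesis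
    by (auto simp: Digraph_Component.connected_def strongly_connected_def reachable_def R_def layered_graph_def)
qed

lemma metric_graph_layered: "metric_graph layered_graph layered_len"
  using connected_layered_graph layered_len_bounds(1)
  by (auto simp: metric_graph_def wf_digraph_def verts_layered intro: less_le_trans[OF zero_less_one])

interpretation layered: uniform_metric_graph layered_graph layered_len 1
  by unfold_locales (auto simp: metric_graph_layered layered_len_bounds)

section \<open>Distances between vertices of the layered graph\<close>

abbreviation ldist :: "nat \<Rightarrow> nat \<Rightarrow> real" where
  "ldist u v \<equiv> graph_dist layered_graph layered_len (Vertex u) (Vertex v)"

lemma Vertex_in_layered: "Vertex v \<in> graph_points layered_graph layered_len"
  by (simp add: verts_layered)

lemmas ldist_triangle = layered.triangle[OF Vertex_in_layered Vertex_in_layered Vertex_in_layered]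

lemma ldist_adjacent:
  assumes "layer v = layer u + 1"
  shows "ldist u v \<le> 1 + weight u + weight v"
proof -
  obtain e where e: "e \<in> arcs layered_graph" "tail layered_graph e = u" "head layered_graph e = v"
    using ex_arc[OF assms] .
  then show ?thesis
    using layered.dist_edge_le[OF e(1), of 0 "layered_len e"] layered_len_bounds(1)[of e]
      layered.edge_point_0[of e] layered.edge_point_len[OF e(1)]
    by (simp add: layered_len_def)
qed

text \<open>The intermediate vertices of the chain can be taken of arbitrarily small weight.\<close>

lemma ldist_upper:
  assumes "layer v = layer u + 1 + int n"
  shows "ldist u v \<le> 1 + real n + weight u + weight v"
  using assms
proof (induction n arbitrary: v)
  case 0
  then show ?case using ldist_adjacent by simp
next
  case (Suc n)
  show ?case
  proof (rule field_le_epsilon)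
    fix \<epsilon> :: real assume "\<epsilon> > 0"
    \<comment> \<open>The weight of \<open>m\<close> is paid twice, on arriving and on leaving,
      hence half of \<open>\<epsilon>\<close>.\<close>
    then obtain m where m: "layer m = layer u + 1 + int n" "weight m < \<epsilon>/2"
      using ex_light_vertex[of "\<epsilon>/2"] by (metis half_gt_zero)
    have "ldist u v \<le> ldist u m + ldist m v" by (rule ldist_triangle)
    also have "\<dots> \<le> (1 + real n + weight u + weight m) + (1 + weight m + weight v)"
      using Suc.IH[OF m(1)] ldist_adjacent[of v m] Suc.prems m(1) by simp
    finally show "ldist u v \<le> 1 + real (Suc n) + weight u + weight v + \<epsilon>"
      using m(2) by simp
  qed
qed

text \<open>The claimed bound, reset to 0 at \<open>u\<close>, is itself a potential. Along an arc
  at \<open>u\<close> it changes by exactly the length of the arc; along any other arc the layer gap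
  changes by 1 and \<open>weight u\<close> cancels.\<close>

lemma ldist_lower:
  assumes "u \<noteq> v"
  shows "\<bar>real_of_int (layer u - layer v)\<bar> + weight u + weight v \<le> ldist u v"
proof -
  define F where "F x = (if x = u then 0 else \<bar>real_of_int (layer u - layer x)\<bar> + weight u + weight x)" for x
  have "\<bar>F (tail layered_graph e) - F (head layered_graph e)\<bar> \<le> layered_len e"
    if "e \<in> arcs layered_graph" for e
    using arc_layer[OF that] weight_pos[of "tail layered_graph e"] weight_pos[of "head layered_graph e"]
    by (auto simp: F_def layered_len_def)
  then have "F v \<le> F u + ldist u v"
    by (rule layered.vertex_potential) (auto simp: verts_layered)
  then show ?thesis using assms by (simp add: F_def)
qed

lemma ldist_eq:
  assumes "layer u \<noteq> layer v"
  shows "ldist u v = \<bar>real_of_int (layer u - layer v)\<bar> + weight u + weight v"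
proof (rule antisym)
  have *: "ldist u v \<le> \<bar>real_of_int (layer u - layer v)\<bar> + weight u + weight v" if "layer u < layer v" for u v
    using ldist_upper[of v u "nat (layer v - layer u - 1)"] that by simp
  show "ldist u v \<le> \<bar>real_of_int (layer u - layer v)\<bar> + weight u + weight v"
    using *[of u v] *[of v u] assms layered.commute[of "Vertex u" "Vertex v"]
    by (cases "layer u < layer v") auto
  show "\<bar>real_of_int (layer u - layer v)\<bar> + weight u + weight v \<le> ldist u v"
    using assms by (intro ldist_lower) auto
qed

text \<open>Two edges through a vertex of the next layer suffice, each of length at most 3.\<close>

lemma ldist_same_layer:
  assumes "layer u = layer v"
  shows "ldist u v \<le> 6"
proof -
  obtain m where m: "layer m = layer u + 1" by (rule ex_light_vertex[of 1]) auto
  have "ldist u v \<le> ldist u m + ldist m v" by (rule ldist_triangle)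
  then show ?thesis
    using ldist_adjacent[of m u] ldist_adjacent[of m v] m assms layered.commute[of "Vertex m" "Vertex v"]
      weight_le_1[of u] weight_le_1[of v] weight_le_1[of m] by simp
qed

text \<open>A detour through \<open>v\<close> costs an extra \<open>2 * weight v\<close>.\<close>

lemma ldist_between:
  assumes "ldist u w = ldist u v + ldist v w"
  shows "ldist u v \<le> 6 \<or> ldist v w \<le> 6"
proof (rule ccontr)
  assume "\<not> ?thesis"
  then have far: "ldist u v > 6" "ldist v w > 6" "ldist u w > 6" using assms by auto
  \<comment> \<open>Vertices of one layer are at distance at most 6, so the three vertices lie in
    three different layers, where \<open>ldist_eq\<close> is available.\<close>
  then have "layer u \<noteq> layer v" "layer v \<noteq> layer w" "layer u \<noteq> layer w"
    using ldist_same_layer by (meson not_le)+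
  then show False
    using assms ldist_eq weight_pos[of v] by simp
qed

text \<open>The constant is \<open>6 + 2 * 3\<close>: the bound for vertices plus twice the bound on
  edge lengths.\<close>

lemma layered_between:
  assumes "x \<in> graph_points layered_graph layered_len" "y \<in> graph_points layered_graph layered_len"
      "z \<in> graph_points layered_graph layered_len"
    and "graph_dist layered_graph layered_len x z =
      graph_dist layered_graph layered_len x y + graph_dist layered_graph layered_len y z"
  shows "graph_dist layered_graph layered_len x y \<le> 12 \<or> graph_dist layered_graph layered_len y z \<le> 12"
  using layered.between_points[of 3 6 x y z, OF layered_len_bounds(2) _ ldist_between _ assms] by simp

lemma layered_quasi_isometric:
  "quasi_isometric (graph_points layered_graph layered_len) (graph_dist layered_graph layered_len)
     (UNIV :: real set) dist"
proof -
  let ?X = "graph_points layered_graph layered_len" and ?d = "graph_dist layered_graph layered_len"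
  \<comment> \<open>The quasi-isometry is the layer number, with interior points of an edge sent to
    the layer of its tail.\<close>
  define base where "base p = (case p of Vertex v \<Rightarrow> v | Inner e t \<Rightarrow> tail layered_graph e)"
    for p :: "(nat, nat) graph_point"
  define f where "f p = real_of_int (layer (base p))" for p
  have base: "?d p (Vertex (base p)) \<le> 3" if "p \<in> ?X" for p
  proof (cases p)
    case (Vertex v)
    then show ?thesis using that by (simp add: base_def)
  next
    case (Inner e t)
    then have "?d p (Vertex (base p)) \<le> t"
      using layered.dist_Inner_tail[of e t] that layered.commute[of p] by (simp add: base_def)
    also have "t \<le> 3" using that Inner layered_len_bounds(2)[of e] by auto
    finally show ?thesis .
  qed
  have vertices: "\<bar>ldist u v - \<bar>real_of_int (layer u) - real_of_int (layer v)\<bar>\<bar> \<le> 6" for u v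
    using ldist_same_layer[of u v] ldist_eq[of u v] weight_le_1[of u] weight_le_1[of v]
      weight_pos[of u] weight_pos[of v] layered.nonneg[of "Vertex u" "Vertex v"]
    by (cases "layer u = layer v") auto
  \<comment> \<open>Moving both points to their base vertices costs at most 3 each, and for vertices
    the distance differs from the layer gap by at most 6.\<close>
  have "\<bar>?d p q - \<bar>f p - f q\<bar>\<bar> \<le> 12" if pq: "p \<in> ?X" "q \<in> ?X" for p q
  proof -
    let ?p = "Vertex (base p)" and ?q = "Vertex (base q)"
    have "?d p q \<le> ?d p ?p + ?d ?p q" "?d ?p q \<le> ?d ?p ?q + ?d ?q q"
      "?d ?p ?q \<le> ?d ?p p + ?d p ?q" "?d p ?q \<le> ?d p q + ?d q ?q"
      using pq Vertex_in_layered by (auto intro: layered.triangle)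
    then have "\<bar>?d p q - ?d ?p ?q\<bar> \<le> 6"
      using base[OF pq(1)] base[OF pq(2)] layered.commute[of p ?p] layered.commute[of q ?q] by linarith
    then show ?thesis using vertices[of "base p" "base q"] unfolding f_def by linarith
  qed
  moreover have "\<exists>p\<in>?X. dist y (f p) \<le> 12" for y
  proof -
    obtain v where "layer v = \<lfloor>y\<rfloor>" by (rule ex_light_vertex[of 1]) auto
    then have "dist y (f (Vertex v)) \<le> 12"
      unfolding f_def base_def dist_real_def by simp linarith
    then show ?thesis using Vertex_in_layered by blast
  qed
  ultimately have "quasi_isometry 1 12 ?X ?d (UNIV :: real set) dist f"
    unfolding quasi_isometry_def by (fastforce simp: dist_real_def abs_le_iff)
  then show ?thesis unfolding quasi_isometric_def by blast
qed

theorem theorem26: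
  shows "\<exists>(G :: (nat, nat) pre_digraph) (len :: nat \<Rightarrow> real).
    metric_graph G len \<and>
    (let X = graph_points G len; d = graph_dist G len in
       path_metric_space X d \<and>
       Metric_space.mcomplete X d \<and>
       quasi_isometric X d (UNIV :: real set) dist \<and>
       \<not> frontier (K3 (UNIV :: (real ^ 2) set) dist) \<subseteq> K3 X d \<and>
       \<not> frontier (K3 (UNIV :: (real ^ 2) set) dist) \<subseteq> K3 (X \<times> X) (prod_dist d d) \<and>
       (\<exists>D. degenerate_triangles_bounded D X d \<and>
            degenerate_triangles_bounded D (X \<times> X) (prod_dist d d)))"
proof -
  let ?X = "graph_points layered_graph layered_len" and ?d = "graph_dist layered_graph layered_len"
  \<comment> \<open>The space itself admits 12; the product needs \<open>2 * 12\<close>, and one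
    constant has to serve both.\<close>
  have D: "degenerate_triangles_bounded 24 ?X ?d"
  proof (rule layered.degenerate_triangles_boundedI)
    fix x y z assume "x \<in> ?X" "y \<in> ?X" "z \<in> ?X" "?d x z = ?d x y + ?d y z"
    from layered_between[OF this] show "?d x y \<le> 24 \<or> ?d y z \<le> 24" by linarith
  qed
  have D2: "degenerate_triangles_bounded 24 (?X \<times> ?X) (prod_dist ?d ?d)"
    using layered.degenerate_triangles_bounded_prod[of 12] layered_between by simp
  show ?thesis
    unfolding Let_def
    by (intro exI[of _ layered_graph] exI[of _ layered_len] conjI exI[of _ 24]
        metric_graph_layered layered.path_metric_space layered.complete layered_quasi_isometric
        frontier_K3_not_subset[OF D] frontier_K3_not_subset[OF D2] D D2)
qed

end
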